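(* Let $G=(V,E,S,T)$ be a geographic network with two disjoint sets of sites $S,T\subset V$, and let $v\in V$ be any vertex. Let $s\in S$ and $t\in T$ be such that $(s,t)$ minimizes the two-color round-trip distance $D_P(v,(\cdot,\cdot))$ from $v$ among all pairs in $S\times T$. Let $p\in S$ and $q\in T$ be sites. Then $$d(v,s)\le \frac{d(v,p)+d(v,q)+d(p,q)}{2}\quad\text{and}\quad d(v,t)\le \frac{d(v,p)+d(v,q)+d(p,q)}{2}.$$
   Context: A geographic network is a finite undirected graph with vertex set $V$ and edge set $E$ (edges being unordered pairs of distinct vertices), together with a weight function assigning a non-negative real number to each edge. It is assumed that any two vertices are joined by a path. For vertices $v,w$, $d(v,w)$ denotes the length (total weight) of a shortest (minimum weight) path between $v$ and $w$. In the two-color setting $G=(V,E,S,T)$, two disjoint subsets $S,T\subset V$ are designated as sets of sites of two different types (colors). For a vertex $v$ and a pair $(s,t)$ with $s\in S$, $t\in T$, the two-color round-trip distance is $D_P(v,(s,t))=d(v,s)+d(v,t)+d(s,t)$. *)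

theory Defs
  imports Complex_Main
begin

text \<open>
  Paths are simple paths, given by their list of vertices; the one-element list is the
  trivial path, so that a vertex has distance 0 to itself.
\<close>

definition net_paths :: "'v set \<Rightarrow> 'v set set \<Rightarrow> 'v \<Rightarrow> 'v \<Rightarrow> 'v list set" where
  "net_paths V E u v =
    {p. p \<noteq> [] \<and> hd p = u \<and> last p = v \<and> set p \<subseteq> V \<and> distinct p \<and>
        successively (\<lambda>x y. {x, y} \<in> E) p}"

definition path_edges :: "'v list \<Rightarrow> 'v set list" where
  "path_edges p = map (\<lambda>(x, y). {x, y}) (zip p (tl p))"

definition path_weight :: "('v set \<Rightarrow> real) \<Rightarrow> 'v list \<Rightarrow> real" where
  "path_weight w p = (\<Sum>e\<leftarrow>path_edges p. w e)"

text \<open>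
  In a geographic network this is a minimum over a finite, non-empty set; see
  \<open>net_dist_attained\<close> and \<open>net_dist_le\<close> below.
\<close>

definition net_dist :: "'v set \<Rightarrow> 'v set set \<Rightarrow> ('v set \<Rightarrow> real) \<Rightarrow> 'v \<Rightarrow> 'v \<Rightarrow> real" where
  "net_dist V E w u v = Min (path_weight w ` net_paths V E u v)"

locale geographic_network =
  fixes V :: "'v set" and E :: "'v set set" and w :: "'v set \<Rightarrow> real"
  assumes finite_vertices: "finite V"
    and edges: "\<And>e. e \<in> E \<Longrightarrow> \<exists>x\<in>V. \<exists>y\<in>V. x \<noteq> y \<and> e = {x, y}"
    and weight_nonneg: "\<And>e. e \<in> E \<Longrightarrow> 0 \<le> w e"
    and connected: "\<And>u v. u \<in> V \<Longrightarrow> v \<in> V \<Longrightarrow> net_paths V E u v \<noteq> {}"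

locale two_color_network = geographic_network V E w
  for V :: "'v set" and E :: "'v set set" and w :: "'v set \<Rightarrow> real" +
  fixes S T :: "'v set"
  assumes sites_S: "S \<subseteq> V"
    and sites_T: "T \<subseteq> V"
    and sites_disjoint: "S \<inter> T = {}"

definition round_trip_dist ::
  "'v set \<Rightarrow> 'v set set \<Rightarrow> ('v set \<Rightarrow> real) \<Rightarrow> 'v \<Rightarrow> 'v \<times> 'v \<Rightarrow> real" where
  "round_trip_dist V E w v =
    (\<lambda>(s, t). net_dist V E w v s + net_dist V E w v t + net_dist V E w s t)"

context geographic_network
begin

lemma finite_net_paths: "finite (net_paths V E u v)"
proof (rule finite_subset)
  show "net_paths V E u v \<subseteq> {p. set p \<subseteq> V \<and> length p \<le> card V}"
    using finite_vertices by (auto simp: net_paths_def distinct_card[symmetric] intro: card_mono)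
  show "finite {p. set p \<subseteq> V \<and> length p \<le> card V}"
    using finite_vertices by (rule finite_lists_length_le)
qed

lemma net_dist_attained:
  assumes "u \<in> V" "v \<in> V"
  obtains p where "p \<in> net_paths V E u v" "net_dist V E w u v = path_weight w p"
proof -
  have "net_dist V E w u v \<in> path_weight w ` net_paths V E u v"
    unfolding net_dist_def
    using finite_net_paths connected[OF assms] by (intro Min_in) auto
  then show thesis using that by auto
qed

lemma net_dist_le: "p \<in> net_paths V E u v \<Longrightarrow> net_dist V E w u v \<le> path_weight w p"
  unfolding net_dist_def using finite_net_paths by (intro Min_le) auto

end

end

theory Submission
  imports Defs
begin

text \<open>
  By symmetry and the triangle inequality for the network distance, each of the distances
  from \<open>v\<close> to \<open>s\<close> and from \<open>v\<close> to \<open>t\<close> is at most half the length of the round trip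
  \<open>v, s, t, v\<close>, which by minimality is no longer than the round trip \<open>v, p, q, v\<close>.
  The triangle inequality holds because cutting closed detours out of a walk does not
  increase its weight.
\<close>

lemma path_weight_simps [simp]:
  "path_weight w [] = 0"
  "path_weight w [x] = 0"
  "path_weight w (x # y # zs) = w {x, y} + path_weight w (y # zs)"
  by (simp_all add: path_weight_def path_edges_def)

text \<open>The cut vertex \<open>y\<close> is kept in both pieces, so every edge falls into exactly
  one of them.\<close>

lemma path_weight_append:
  "path_weight w (xs @ y # ys) = path_weight w (xs @ [y]) + path_weight w (y # ys)"
  by (induction xs rule: induct_list012) auto

lemma path_weight_rev: "path_weight w (rev p) = path_weight w p"
proof (induction p rule: induct_list012)
  case (3 x y zs)
  have "path_weight w (rev (x # y # zs)) = path_weight w (rev zs @ [y]) + path_weight w [y, x]"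
    using path_weight_append[of w "rev zs" y "[x]"] by simp
  with 3 show ?case by (simp add: insert_commute)
qed simp_all

context geographic_network
begin

lemma path_weight_nonneg: "successively (\<lambda>x y. {x, y} \<in> E) p \<Longrightarrow> 0 \<le> path_weight w p"
  by (induction p rule: induct_list012) (auto simp: weight_nonneg)

text \<open>Extends \<open>net_dist_le\<close> to walks with repeated vertices, as arise when
  shortest paths are concatenated. Induction on length: a repeated vertex bounds a closed detour,
  whose weight is non-negative.\<close>

lemma net_dist_le_walk:
  assumes "p \<noteq> []" "set p \<subseteq> V" "successively (\<lambda>x y. {x, y} \<in> E) p"
  shows "net_dist V E w (hd p) (last p) \<le> path_weight w p"
  using assms
proof (induction p rule: length_induct)
  case (1 p)
  show ?case
  proof (cases "distinct p")
    case True
    with "1.prems" show ?thesis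
      by (intro net_dist_le) (simp add: net_paths_def)
  next
    case False
    then obtain xs y ys zs where p: "p = xs @ [y] @ ys @ [y] @ zs"
      using not_distinct_decomp by blast
    \<comment> \<open>One copy of \<open>y\<close> stays, so the ends of the walk survive even if
      \<open>xs\<close> or \<open>zs\<close> is empty.\<close>
    let ?p' = "xs @ y # zs"
    have walk: "successively (\<lambda>x y. {x, y} \<in> E) ?p'"
      and detour: "successively (\<lambda>x y. {x, y} \<in> E) (y # ys @ [y])"
      using "1.prems"(3) unfolding p by (auto simp: successively_append_iff successively_Cons hd_append)
    have "path_weight w p = path_weight w ?p' + path_weight w (y # ys @ [y])"
      \<comment> \<open>Splits \<open>p\<close> at both occurrences of \<open>y\<close>, and
        \<open>?p'\<close> at the one that was kept.\<close>
      using path_weight_append[of w xs y "ys @ y # zs"] path_weight_append[of w "y # ys" y zs]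
        path_weight_append[of w xs y zs]
      unfolding p by simp
    then have "path_weight w ?p' \<le> path_weight w p"
      using path_weight_nonneg[OF detour] by simp
    moreover have "net_dist V E w (hd ?p') (last ?p') \<le> path_weight w ?p'"
      using "1.IH"[rule_format, of ?p'] "1.prems"(2) walk unfolding p by simp
    moreover have "hd ?p' = hd p" "last ?p' = last p"
      unfolding p by (simp_all add: hd_append)
    ultimately show ?thesis by simp
  qed
qed

lemma net_dist_triangle:
  assumes "x \<in> V" "y \<in> V" "z \<in> V"
  shows "net_dist V E w x z \<le> net_dist V E w x y + net_dist V E w y z"
proof -
  obtain p where p: "p \<in> net_paths V E x y" "net_dist V E w x y = path_weight w p"
    using net_dist_attained assms(1,2) .
  obtain q where q: "q \<in> net_paths V E y z" "net_dist V E w y z = path_weight w q"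
    using net_dist_attained assms(2,3) .
  \<comment> \<open>The common end \<open>y\<close> is split off both paths so that it occurs only
    once at the joint.\<close>
  obtain p' where p': "p = p' @ [y]"
    using p(1) by (auto simp: net_paths_def intro: append_butlast_last_id[symmetric])
  obtain q' where q': "q = y # q'"
    using q(1) by (cases q) (auto simp: net_paths_def)
  have "net_dist V E w (hd (p' @ y # q')) (last (p' @ y # q')) \<le> path_weight w (p' @ y # q')"
    using p(1) q(1) unfolding p' q'
    by (intro net_dist_le_walk) (auto simp: net_paths_def successively_append_iff)
  moreover have "hd (p' @ y # q') = x" "last (p' @ y # q') = z"
    using p(1) q(1) unfolding p' q' by (auto simp: net_paths_def hd_append)
  ultimately show ?thesis
    using path_weight_append[of w p' y q'] p(2) q(2) unfolding p' q' by simp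
qed

lemma net_dist_commute: "net_dist V E w x y = net_dist V E w y x"
proof -
  have rev_mem: "rev p \<in> net_paths V E b a" if "p \<in> net_paths V E a b" for a b p
    using that by (auto simp: net_paths_def hd_rev last_rev insert_commute)
  \<comment> \<open>For arbitrary \<open>a\<close> and \<open>b\<close>, this gives both inclusions:
    the two minima range over the same set of weights.\<close>
  have "path_weight w ` net_paths V E a b \<subseteq> path_weight w ` net_paths V E b a" for a b
    using rev_mem[of _ a b] by (metis image_subsetI image_eqI path_weight_rev)
  then show ?thesis
    unfolding net_dist_def by (metis subset_antisym)
qed

text \<open>Adding the direct distance to the triangle inequality through the other site completes
  the round trip on the right.\<close>

lemma double_net_dist_le_round_trip_dist:
  assumes "v \<in> V" "s \<in> V" "t \<in> V"
  shows "2 * net_dist V E w v s \<le> round_trip_dist V E w v (s, t)"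
    and "2 * net_dist V E w v t \<le> round_trip_dist V E w v (s, t)"
  using net_dist_triangle[of v t s] net_dist_triangle[of v s t] net_dist_commute[of s t] assms
  by (simp_all add: round_trip_dist_def)

end

theorem lemma5:
  fixes V :: "'v set" and E :: "'v set set" and w :: "'v set \<Rightarrow> real"
    and S T :: "'v set" and v s t p q :: 'v
  assumes "two_color_network V E w S T"
    and "v \<in> V"
    and "s \<in> S" and "t \<in> T"
    and "is_arg_min (round_trip_dist V E w v) (\<lambda>x. x \<in> S \<times> T) (s, t)"
    and "p \<in> S" and "q \<in> T"
  shows "net_dist V E w v s
           \<le> (net_dist V E w v p + net_dist V E w v q + net_dist V E w p q) / 2
       \<and> net_dist V E w v t
           \<le> (net_dist V E w v p + net_dist V E w v q + net_dist V E w p q) / 2"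
proof -
  interpret two_color_network V E w S T by fact
  have "round_trip_dist V E w v (s, t) \<le> round_trip_dist V E w v (p, q)"
    \<comment> \<open>The pair \<open>(p, q)\<close> competes in the minimization over
      \<open>S \<times> T\<close>.\<close>
    using assms(5-7) by (force simp: is_arg_min_linorder)
  moreover have "s \<in> V" "t \<in> V"
    using assms(3,4) sites_S sites_T by auto
  ultimately show ?thesis
    using double_net_dist_le_round_trip_dist[of v s t] assms(2)
    by (simp add: round_trip_dist_def)
qed

end
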